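(* Let $(M,g)$ be a compact oriented Riemannian manifold of dimension $n>2$ which is an $m$-quasi Einstein manifold with potential function $f$; that is, for constants $\lambda\in\mathbb{R}$ and $0<m\le\infty$, the smooth vector field $X=\nabla f$ with $f\in C^\infty(M)$ satisfies $$Ric+\frac12\pounds_X g-\frac1m X^\flat\otimes X^\flat=\lambda g,\qquad\text{equivalently}\qquad Ric+\nabla^2 f-\frac1m\,df\otimes df=\lambda g .$$ Let $\xi\in C^\infty(M)$ be the Hodge-de Rham potential of $X$. Then $f$ agrees with $\xi$ up to a constant, i.e. there is a constant $C_1\in\mathbb{R}$ such that $f=\xi+C_1$ on $M$.
   Context: Manifolds are smooth and connected (and without boundary). $Ric$ is the Ricci tensor, $\pounds_X$ the Lie derivative, $X^\flat$ the 1-form dual to $X$ with respect to $g$, and $\nabla^2 f$ the Hessian of $f$. For $m=\infty$ the $\frac1m$ term is understood to be $0$. Hodge-de Rham decomposition: on a compact oriented Riemannian manifold every smooth vector field $X$ can be written as $X=W+\nabla\xi$ with $\operatorname{div}W=0$ and $\xi\in C^\infty(M)$; the function $\xi$ (determined up to an additive constant) is called the Hodge-de Rham potential of $X$. *)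

theory Defs
  imports "HOL-Analysis.Analysis"
begin

section \<open>Smooth functions on Euclidean space\<close>

definition partial_deriv :: "'n \<Rightarrow> (real^'n \<Rightarrow> real) \<Rightarrow> real^'n \<Rightarrow> real" where
  "partial_deriv i F x = frechet_derivative F (at x) (axis i 1)"

text \<open>Used for open \<open>S\<close> only: all iterated partial derivatives exist and are (totally)
  differentiable, hence continuous, on \<open>S\<close>.\<close>

definition smooth_on :: "(real^'n) set \<Rightarrow> (real^'n \<Rightarrow> real) \<Rightarrow> bool" where
  "smooth_on S F \<longleftrightarrow> (\<forall>is. foldr partial_deriv is F differentiable_on S)"

section \<open>Smooth manifolds\<close>

text \<open>A chart is a pair of its domain and its coordinate map; the values of the coordinate map
  outside the domain are irrelevant.\<close>

type_synonym ('a, 'n) chart = "'a set \<times> ('a \<Rightarrow> real^'n)"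

definition chart_inv :: "('a, 'n) chart \<Rightarrow> real^'n \<Rightarrow> 'a" where
  "chart_inv c = inv_into (fst c) (snd c)"

definition transition :: "('a, 'n) chart \<Rightarrow> ('a, 'n) chart \<Rightarrow> real^'n \<Rightarrow> real^'n" where
  "transition c d = snd d \<circ> chart_inv c"

definition is_chart :: "'a topology \<Rightarrow> ('a, 'n::finite) chart \<Rightarrow> bool" where
  "is_chart M c \<longleftrightarrow> openin M (fst c) \<and> open (snd c ` fst c) \<and>
     homeomorphic_map (subtopology M (fst c)) (top_of_set (snd c ` fst c)) (snd c)"

definition smooth_atlas :: "'a topology \<Rightarrow> ('a, 'n::finite) chart set \<Rightarrow> bool" where
  "smooth_atlas M A \<longleftrightarrow>
     (\<forall>c\<in>A. is_chart M c) \<and> (\<Union>c\<in>A. fst c) = topspace M \<and>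
     (\<forall>c\<in>A. \<forall>d\<in>A. \<forall>i. smooth_on (snd c ` (fst c \<inter> fst d)) (\<lambda>x. transition c d x $ i))"

definition smooth_manifold :: "'a topology \<Rightarrow> ('a, 'n::finite) chart set \<Rightarrow> bool" where
  "smooth_manifold M A \<longleftrightarrow> Hausdorff_space M \<and> second_countable M \<and> smooth_atlas M A"

definition transition_jacobian ::
  "('a, 'n::finite) chart \<Rightarrow> ('a, 'n) chart \<Rightarrow> 'a \<Rightarrow> real^'n^'n" where
  "transition_jacobian c d p = jacobian (transition c d) (at (snd c p))"

text \<open>An oriented manifold is one given by an atlas whose coordinate changes all preserve
  orientation. The atlas is not required to be maximal.\<close>

definition oriented_smooth_manifold :: "'a topology \<Rightarrow> ('a, 'n::finite) chart set \<Rightarrow> bool" where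
  "oriented_smooth_manifold M A \<longleftrightarrow> smooth_manifold M A \<and>
     (\<forall>c\<in>A. \<forall>d\<in>A. \<forall>p\<in>fst c \<inter> fst d. det (transition_jacobian c d p) > 0)"

section \<open>Smooth functions, vector fields and metrics\<close>

definition smooth_in_chart :: "('a, 'n::finite) chart \<Rightarrow> ('a \<Rightarrow> real) \<Rightarrow> bool" where
  "smooth_in_chart c u \<longleftrightarrow> smooth_on (snd c ` fst c) (u \<circ> chart_inv c)"

definition smooth_function :: "('a, 'n::finite) chart set \<Rightarrow> ('a \<Rightarrow> real) \<Rightarrow> bool" where
  "smooth_function A u \<longleftrightarrow> (\<forall>c\<in>A. smooth_in_chart c u)"

text \<open>The coordinate derivative \<open>\<partial>u/\<partial>x\<^sup>i\<close> at a point of the domain of the chart, for a real function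
  \<open>u\<close> defined (at least) on that domain.\<close>

definition chart_deriv :: "('a, 'n::finite) chart \<Rightarrow> 'n \<Rightarrow> ('a \<Rightarrow> real) \<Rightarrow> 'a \<Rightarrow> real" where
  "chart_deriv c i u p = partial_deriv i (u \<circ> chart_inv c) (snd c p)"

text \<open>Tensor fields are given by their components with respect to each chart, subject to the usual
  transformation law. \<open>X c p $ i\<close> is the component \<open>X\<^sup>i(p)\<close> and \<open>g c p $ i $ j\<close> the component
  \<open>g\<^sub>i\<^sub>j(p)\<close> with respect to \<open>c\<close>; both are meaningful only for \<open>p\<close> in the domain of \<open>c\<close>.\<close>

type_synonym ('a, 'n) vector_field = "('a, 'n) chart \<Rightarrow> 'a \<Rightarrow> real^'n"
type_synonym ('a, 'n) metric = "('a, 'n) chart \<Rightarrow> 'a \<Rightarrow> real^'n^'n"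

definition smooth_vector_field ::
  "('a, 'n::finite) chart set \<Rightarrow> ('a, 'n) vector_field \<Rightarrow> bool" where
  "smooth_vector_field A X \<longleftrightarrow>
     (\<forall>c\<in>A. \<forall>i. smooth_in_chart c (\<lambda>p. X c p $ i)) \<and>
     (\<forall>c\<in>A. \<forall>d\<in>A. \<forall>p\<in>fst c \<inter> fst d. X d p = transition_jacobian c d p *v X c p)"

definition riemannian_metric :: "('a, 'n::finite) chart set \<Rightarrow> ('a, 'n) metric \<Rightarrow> bool" where
  "riemannian_metric A g \<longleftrightarrow>
     (\<forall>c\<in>A. \<forall>i j. smooth_in_chart c (\<lambda>p. g c p $ i $ j)) \<and>
     (\<forall>c\<in>A. \<forall>p\<in>fst c. transpose (g c p) = g c p \<and> (\<forall>v. v \<noteq> 0 \<longrightarrow> v \<bullet> (g c p *v v) > 0)) \<and>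
     (\<forall>c\<in>A. \<forall>d\<in>A. \<forall>p\<in>fst c \<inter> fst d.
        g c p = transpose (transition_jacobian c d p) ** g d p ** transition_jacobian c d p)"

definition gradient :: "('a, 'n::finite) metric \<Rightarrow> ('a \<Rightarrow> real) \<Rightarrow> ('a, 'n) vector_field" where
  "gradient g u c p = matrix_inv (g c p) *v (\<chi> i. chart_deriv c i u p)"

section \<open>Levi-Civita connection, divergence and Ricci curvature\<close>

text \<open>\<open>christoffel g c k i j p\<close> is \<open>\<Gamma>\<^sup>k\<^sub>i\<^sub>j(p)\<close>, that is \<open>\<nabla>\<^sub>i \<partial>\<^sub>j = \<Gamma>\<^sup>k\<^sub>i\<^sub>j \<partial>\<^sub>k\<close> for the Levi-Civita connection.\<close>

definition christoffel ::
  "('a, 'n::finite) metric \<Rightarrow> ('a, 'n) chart \<Rightarrow> 'n \<Rightarrow> 'n \<Rightarrow> 'n \<Rightarrow> 'a \<Rightarrow> real" where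
  "christoffel g c k i j p =
     (1/2) * (\<Sum>l\<in>UNIV. matrix_inv (g c p) $ k $ l *
        (chart_deriv c i (\<lambda>q. g c q $ j $ l) p + chart_deriv c j (\<lambda>q. g c q $ i $ l) p
          - chart_deriv c l (\<lambda>q. g c q $ i $ j) p))"

text \<open>\<open>covariant_deriv g X c i k p\<close> is \<open>(\<nabla>\<^sub>i X)\<^sup>k(p)\<close>.\<close>

definition covariant_deriv ::
  "('a, 'n::finite) metric \<Rightarrow> ('a, 'n) vector_field \<Rightarrow> ('a, 'n) chart \<Rightarrow> 'n \<Rightarrow> 'n \<Rightarrow> 'a \<Rightarrow> real" where
  "covariant_deriv g X c i k p =
     chart_deriv c i (\<lambda>q. X c q $ k) p + (\<Sum>j\<in>UNIV. christoffel g c k i j p * X c p $ j)"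

definition divergence ::
  "('a, 'n::finite) metric \<Rightarrow> ('a, 'n) vector_field \<Rightarrow> ('a, 'n) chart \<Rightarrow> 'a \<Rightarrow> real" where
  "divergence g X c p = (\<Sum>i\<in>UNIV. covariant_deriv g X c i i p)"

text \<open>\<open>riemann g c l i j k\<close> is the component \<open>R\<^sup>l\<^sub>i\<^sub>j\<^sub>k\<close> in
  \<open>R(\<partial>\<^sub>i,\<partial>\<^sub>j)\<partial>\<^sub>k = \<nabla>\<^sub>i\<nabla>\<^sub>j\<partial>\<^sub>k - \<nabla>\<^sub>j\<nabla>\<^sub>i\<partial>\<^sub>k = R\<^sup>l\<^sub>i\<^sub>j\<^sub>k \<partial>\<^sub>l\<close>.\<close>

definition riemann ::
  "('a, 'n::finite) metric \<Rightarrow> ('a, 'n) chart \<Rightarrow> 'n \<Rightarrow> 'n \<Rightarrow> 'n \<Rightarrow> 'n \<Rightarrow> 'a \<Rightarrow> real" where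
  "riemann g c l i j k p =
     chart_deriv c i (christoffel g c l j k) p - chart_deriv c j (christoffel g c l i k) p
     + (\<Sum>r\<in>UNIV. christoffel g c l i r p * christoffel g c r j k p
                 - christoffel g c l j r p * christoffel g c r i k p)"

text \<open>\<open>Ric(Y,Z)\<close> is the trace of \<open>V \<mapsto> R(V,Y)Z\<close>, which is positive on round spheres.\<close>

definition ricci ::
  "('a, 'n::finite) metric \<Rightarrow> ('a, 'n) chart \<Rightarrow> 'n \<Rightarrow> 'n \<Rightarrow> 'a \<Rightarrow> real" where
  "ricci g c j k p = (\<Sum>i\<in>UNIV. riemann g c i i j k p)"

text \<open>Components of the Lie derivative of the metric:
  \<open>X\<^sup>k \<partial>\<^sub>k g\<^sub>i\<^sub>j + g\<^sub>k\<^sub>j \<partial>\<^sub>i X\<^sup>k + g\<^sub>i\<^sub>k \<partial>\<^sub>j X\<^sup>k\<close>.\<close>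

definition lie_deriv_metric ::
  "('a, 'n::finite) metric \<Rightarrow> ('a, 'n) vector_field \<Rightarrow> ('a, 'n) chart \<Rightarrow> 'n \<Rightarrow> 'n \<Rightarrow> 'a \<Rightarrow> real" where
  "lie_deriv_metric g X c i j p =
     (\<Sum>k\<in>UNIV. X c p $ k * chart_deriv c k (\<lambda>q. g c q $ i $ j) p
        + g c p $ k $ j * chart_deriv c i (\<lambda>q. X c q $ k) p
        + g c p $ i $ k * chart_deriv c j (\<lambda>q. X c q $ k) p)"

definition flat :: "('a, 'n::finite) metric \<Rightarrow> ('a, 'n) vector_field \<Rightarrow> ('a, 'n) vector_field" where
  "flat g X c p = g c p *v X c p"

section \<open>Quasi-Einstein manifolds and the Hodge-de Rham potential\<close>

text \<open>For \<open>m = \<infinity>\<close> the coefficient \<open>1 / m\<close> is \<open>0\<close>.\<close>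

definition quasi_einstein ::
  "('a, 'n::finite) chart set \<Rightarrow> ('a, 'n) metric \<Rightarrow> ('a, 'n) vector_field \<Rightarrow> ereal \<Rightarrow> real \<Rightarrow> bool" where
  "quasi_einstein A g X m lam \<longleftrightarrow>
     (\<forall>c\<in>A. \<forall>p\<in>fst c. \<forall>i j.
        ricci g c i j p + (1/2) * lie_deriv_metric g X c i j p
          - real_of_ereal (1 / m) * (flat g X c p $ i * flat g X c p $ j)
        = lam * g c p $ i $ j)"

definition hodge_de_rham_potential ::
  "('a, 'n::finite) chart set \<Rightarrow> ('a, 'n) metric \<Rightarrow> ('a, 'n) vector_field \<Rightarrow> ('a \<Rightarrow> real) \<Rightarrow> bool" where
  "hodge_de_rham_potential A g X xi \<longleftrightarrow> smooth_function A xi \<and>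
     (\<exists>W. smooth_vector_field A W \<and>
        (\<forall>c\<in>A. \<forall>p\<in>fst c. divergence g W c p = 0 \<and> X c p = W c p + gradient g xi c p))"

end

theory Submission
  imports Defs
begin

text \<open>The divergence-free part of \<open>X = \<nabla>f\<close> is \<open>W = \<nabla>(f - \<xi>)\<close>, so \<open>f - \<xi>\<close> is harmonic. In a chart the
  Laplacian is a second-order elliptic operator without zeroth-order term and with continuous
  coefficients, so Hopf's strong maximum principle makes the set where \<open>f - \<xi>\<close> attains its maximum
  open. This set is closed, and nonempty by compactness, hence it is all of the connected
  manifold.\<close>

text \<open>Constancy of a harmonic function is often obtained by integrating
  \<open>f - \<xi>\<close> against its Laplacian, which takes a volume form and the divergence
  theorem on M. The maximum principle works in one chart at a time and leaves the gluing to
  topology. The absence of a zeroth-order term matters because constants are then annihilated, so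
  the maximal value may have either sign. The obstacle in a chart is that the divergence is given in
  components of W, not in second derivatives of \<open>f - \<xi>\<close>. These come from
  differentiating d(f - \<xi>) = g W, where the derivatives fall on g and W and never on the inverse
  metric; continuity of the inverse metric is then enough.\<close>

section \<open>Strong maximum principle\<close>

text \<open>Induction by completing the square: the Schur complement of the diagonal entry \<open>a k k\<close> is
  again positive definite.\<close>

lemma trace_posdef_nonpos:
  fixes a H :: "'b \<Rightarrow> 'b \<Rightarrow> real"
  assumes "finite S"
    and "\<And>i j. i \<in> S \<Longrightarrow> j \<in> S \<Longrightarrow> a i j = a j i"
    and "\<And>v. \<exists>i\<in>S. v i \<noteq> 0 \<Longrightarrow> (\<Sum>i\<in>S. \<Sum>j\<in>S. v i * v j * a i j) > 0"
    and "\<And>v. (\<Sum>i\<in>S. \<Sum>j\<in>S. v i * v j * H i j) \<le> 0"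
  shows "(\<Sum>i\<in>S. \<Sum>j\<in>S. a i j * H i j) \<le> 0"
  using assms
proof (induction S arbitrary: a rule: finite_induct)
  case empty
  then show ?case by simp
next
  case (insert k S)
  note sym = insert.prems(1) and pd = insert.prems(2) and neg = insert.prems(3)
  have split: "(\<Sum>i\<in>insert k S. \<Sum>j\<in>insert k S. v i * v j * B i j)
      = v k * v k * B k k + (\<Sum>j\<in>S. v k * v j * B k j) + (\<Sum>i\<in>S. v i * v k * B i k)
        + (\<Sum>i\<in>S. \<Sum>j\<in>S. v i * v j * B i j)" for v and B :: "'b \<Rightarrow> 'b \<Rightarrow> real"
    using insert.hyps by (simp add: sum.distrib)
  have ne: "i \<noteq> k" if "i \<in> S" for i using that insert.hyps by auto
  have akk: "a k k > 0"
  proof -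
    have "(\<Sum>i\<in>S. \<Sum>j\<in>S. (if i = k then 1 else 0) * (if j = k then 1 else 0) * a i j) = 0"
      by (intro sum.neutral ballI) (auto dest: ne)
    moreover have "(\<Sum>j\<in>S. (if j = k then 1 else 0) * a k j) = 0"
      by (intro sum.neutral ballI) (auto dest: ne)
    moreover have "(\<Sum>i\<in>S. (if i = k then 1 else 0) * a i k) = 0"
      by (intro sum.neutral ballI) (auto dest: ne)
    ultimately show ?thesis
      using pd[of "\<lambda>i. if i = k then 1 else 0"] unfolding split by simp
  qed
  define a' where "a' i j = a i j - a k i * a k j / a k k" for i j
  have a'k: "a' k j = 0" "a' j k = 0" if "j \<in> S" for j
    using akk sym[of j k] that by (auto simp: a'_def)
  have a'kk: "a' k k = 0" using akk by (simp add: a'_def)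
  have IH: "(\<Sum>i\<in>S. \<Sum>j\<in>S. a' i j * H i j) \<le> 0"
  proof (rule insert.IH)
    show "a' i j = a' j i" if "i \<in> S" "j \<in> S" for i j
      using sym[of i j] that by (simp add: a'_def)
  next
    fix v :: "'b \<Rightarrow> real"
    assume v: "\<exists>i\<in>S. v i \<noteq> 0"
    define s where "s = (\<Sum>j\<in>S. v j * a k j)"
    \<comment> \<open>The entry at k minimises the form of \<open>a\<close> among all extensions of
      v to k. At this minimiser the form of \<open>a\<close> equals the form of the Schur complement
      at v, so its positivity is inherited.\<close>
    define w where "w = v(k := - s / a k k)"
    have w: "w i = v i" if "i \<in> S" for i using ne[OF that] by (simp add: w_def)
    have "(\<Sum>i\<in>insert k S. \<Sum>j\<in>insert k S. w i * w j * a i j) > 0"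
      using v w by (intro pd) auto
    also have "(\<Sum>i\<in>insert k S. \<Sum>j\<in>insert k S. w i * w j * a i j)
       = w k * w k * a k k + w k * s + w k * s + (\<Sum>i\<in>S. \<Sum>j\<in>S. v i * v j * a i j)"
      unfolding split s_def sum_distrib_left
      by (intro arg_cong2[where f = "(+)"] sum.cong refl) (use w sym in \<open>auto simp: algebra_simps\<close>)
    also have "w k * w k * a k k + w k * s + w k * s = - (s * s / a k k)"
      using akk by (simp add: w_def field_simps)
    also have "- (s * s / a k k) + (\<Sum>i\<in>S. \<Sum>j\<in>S. v i * v j * a i j)
       = (\<Sum>i\<in>S. \<Sum>j\<in>S. v i * v j * a' i j)"
      unfolding s_def sum_product sum_divide_distrib a'_def
      by (simp add: right_diff_distrib sum_subtractf algebra_simps)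
    finally show "(\<Sum>i\<in>S. \<Sum>j\<in>S. v i * v j * a' i j) > 0" .
  next
    fix v :: "'b \<Rightarrow> real"
    define w where "w = v(k := 0)"
    have w: "w i = v i" if "i \<in> S" for i using ne[OF that] by (simp add: w_def)
    have "w k = 0" by (simp add: w_def)
    then show "(\<Sum>i\<in>S. \<Sum>j\<in>S. v i * v j * H i j) \<le> 0"
      using neg[of w] unfolding split by (simp add: w cong: sum.cong)
  qed
  \<comment> \<open>The rank-one part removed from \<open>a\<close> pairs with H to the value of the
    form H at the row \<open>a k\<close>, divided by \<open>a k k\<close>, hence it is \<le> 0 as
    well.\<close>
  have "(\<Sum>i\<in>insert k S. \<Sum>j\<in>insert k S. a i j * H i j)
     = (\<Sum>i\<in>insert k S. \<Sum>j\<in>insert k S. a k i * a k j * H i j) / a k k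
       + (\<Sum>i\<in>insert k S. \<Sum>j\<in>insert k S. a' i j * H i j)"
    unfolding sum_divide_distrib sum.distrib[symmetric]
    by (intro sum.cong refl) (simp add: a'_def field_simps akk)
  also have "(\<Sum>i\<in>insert k S. \<Sum>j\<in>insert k S. a' i j * H i j) = (\<Sum>i\<in>S. \<Sum>j\<in>S. a' i j * H i j)"
    using insert.hyps by (simp add: a'k a'kk)
  finally show ?case
    using IH neg[of "a k"] akk by (simp add: divide_nonpos_pos add_nonpos_nonpos)
qed

section \<open>Necessary conditions at an interior maximum\<close>

text \<open>If c were positive, \<phi>', which vanishes at 0, would be positive just to the right of
  0, and \<phi> would increase there. This takes differentiability of \<phi>' at the point 0
  alone.\<close>

lemma second_derivative_nonpos_at_max:
  fixes \<phi> \<phi>' :: "real \<Rightarrow> real"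
  assumes "d > 0"
    and D: "\<And>t. \<bar>t\<bar> < d \<Longrightarrow> (\<phi> has_real_derivative \<phi>' t) (at t)"
    and D2: "(\<phi>' has_real_derivative c) (at 0)"
    and max: "\<And>t. \<bar>t\<bar> < d \<Longrightarrow> \<phi> t \<le> \<phi> 0"
  shows "\<phi>' 0 = 0" and "c \<le> 0"
proof -
  show z: "\<phi>' 0 = 0"
    using DERIV_local_max[OF D[of 0] \<open>d > 0\<close>] \<open>d > 0\<close> max by simp
  show "c \<le> 0"
  proof (rule ccontr)
    assume "\<not> c \<le> 0"
    then obtain e where e: "e > 0" "\<And>h. 0 < h \<Longrightarrow> h < e \<Longrightarrow> \<phi>' h > 0"
      using DERIV_pos_inc_right[OF D2] z by auto
    define t where "t = min d e / 2"
    have t: "0 < t" "t < d" "t < e" using e \<open>d > 0\<close> by (auto simp: t_def)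
    have "\<phi> 0 < \<phi> t"
    proof (rule DERIV_pos_imp_increasing_open[OF \<open>0 < t\<close>])
      show "\<exists>y. (\<phi> has_real_derivative y) (at x) \<and> y > 0" if "0 < x" "x < t" for x
        using D[of x] e(2)[of x] that t by auto
      show "continuous_on {0..t} \<phi>"
        using t by (intro continuous_at_imp_continuous_on ballI DERIV_isCont[OF D]) auto
    qed
    then show False using max[of t] t by auto
  qed
qed

text \<open>Restriction to the lines t \<mapsto> z + t e reduces this to one variable. The matrix H
  may be asymmetric: along a line, and later in the pairing with a symmetric matrix, its quadratic
  form is all that counts.\<close>

lemma multivariate_max_conditions:
  fixes v :: "real^'n::finite \<Rightarrow> real" and Dv :: "'n \<Rightarrow> real^'n \<Rightarrow> real"
  assumes "open S" "z \<in> S"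
    and D: "\<And>x. x \<in> S \<Longrightarrow> (v has_derivative (\<lambda>d. \<Sum>i\<in>UNIV. d $ i * Dv i x)) (at x)"
    and D2: "\<And>i. (Dv i has_derivative (\<lambda>d. \<Sum>j\<in>UNIV. d $ j * H i j)) (at z)"
    and max: "\<And>x. x \<in> S \<Longrightarrow> v x \<le> v z"
  shows "Dv i z = 0" and "(\<Sum>i\<in>UNIV. \<Sum>j\<in>UNIV. e i * e j * H i j) \<le> 0"
proof -
  have *: "(\<Sum>i\<in>UNIV. e $ i * Dv i z) = 0 \<and> (\<Sum>i\<in>UNIV. \<Sum>j\<in>UNIV. e $ i * e $ j * H i j) \<le> 0"
    for e :: "real^'n"
  proof -
    have "continuous (at 0) (\<lambda>t::real. z + t *\<^sub>R e)" by (intro continuous_intros)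
    then have "\<forall>\<^sub>F t in at 0. z + t *\<^sub>R e \<in> S"
      using assms(1,2) by (auto simp: continuous_at dest!: topological_tendstoD[of _ _ _ S])
    then obtain d where d: "d > 0" "\<And>t. \<bar>t\<bar> < d \<Longrightarrow> z + t *\<^sub>R e \<in> S"
      using \<open>z \<in> S\<close> by (auto simp: eventually_at dist_real_def)
        (metis add.right_neutral scale_eq_0_iff)
    have line: "((\<lambda>s. z + s *\<^sub>R e) has_derivative (\<lambda>s. s *\<^sub>R e)) (at t)" for t
      by (auto intro!: derivative_eq_intros)
    have 1: "((\<lambda>s. v (z + s *\<^sub>R e)) has_real_derivative (\<Sum>i\<in>UNIV. e $ i * Dv i (z + t *\<^sub>R e))) (at t)"
      if "\<bar>t\<bar> < d" for t
      unfolding has_field_derivative_def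
      by (rule has_derivative_eq_rhs[OF has_derivative_compose[OF line D[OF d(2)[OF that]]]])
        (simp add: fun_eq_iff sum_distrib_left mult_ac)
    have 2: "((\<lambda>t. \<Sum>i\<in>UNIV. e $ i * Dv i (z + t *\<^sub>R e)) has_real_derivative
          (\<Sum>i\<in>UNIV. e $ i * (\<Sum>j\<in>UNIV. e $ j * H i j))) (at 0)"
    proof (intro DERIV_sum DERIV_cmult)
      fix i
      have "(Dv i has_derivative (\<lambda>d. \<Sum>j\<in>UNIV. d $ j * H i j)) (at (z + 0 *\<^sub>R e))"
        using D2 by simp
      from has_derivative_compose[OF line this]
      show "((\<lambda>t. Dv i (z + t *\<^sub>R e)) has_real_derivative (\<Sum>j\<in>UNIV. e $ j * H i j)) (at 0)"
        unfolding has_field_derivative_def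
        by (rule has_derivative_eq_rhs) (simp add: fun_eq_iff sum_distrib_left mult_ac)
    qed
    show ?thesis
      using second_derivative_nonpos_at_max[OF d(1) 1 2] max[OF d(2)]
      by (simp add: sum_distrib_left mult.assoc)
  qed
  show "Dv i z = 0"
    using *[of "axis i 1"] by (simp add: axis_def if_distrib[of "\<lambda>t. t * _"] cong: if_cong)
  show "(\<Sum>i\<in>UNIV. \<Sum>j\<in>UNIV. e i * e j * H i j) \<le> 0"
    using *[of "\<chi> i. e i"] by simp
qed

section \<open>Elliptic operators and Hopf's argument\<close>

text \<open>The operator acts on given first and second derivatives instead of on a function. This
  makes it visibly linear in the pair D, H, and lets the barrier supply its derivatives by explicit
  formulas.\<close>

definition second_order_op ::
  "(real^'n \<Rightarrow> 'n::finite \<Rightarrow> 'n \<Rightarrow> real) \<Rightarrow> (real^'n \<Rightarrow> 'n \<Rightarrow> real) \<Rightarrow>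
   ('n \<Rightarrow> real^'n \<Rightarrow> real) \<Rightarrow> ('n \<Rightarrow> 'n \<Rightarrow> real^'n \<Rightarrow> real) \<Rightarrow> real^'n \<Rightarrow> real" where
  "second_order_op a b D H x =
     (\<Sum>i\<in>UNIV. \<Sum>j\<in>UNIV. a x i j * H i j x) + (\<Sum>i\<in>UNIV. b x i * D i x)"

text \<open>Positivity of \<open>a\<close> is pointwise, without a uniform lower bound; the barrier
  obtains its estimate near a point from continuity of the coefficients.\<close>

locale elliptic_operator =
  fixes \<Omega> :: "(real^'n::finite) set"
    and a :: "real^'n \<Rightarrow> 'n \<Rightarrow> 'n \<Rightarrow> real" and b :: "real^'n \<Rightarrow> 'n \<Rightarrow> real"
  assumes open_dom: "open \<Omega>"
    and a_cont: "\<And>i j. continuous_on \<Omega> (\<lambda>x. a x i j)"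
    and b_cont: "\<And>i. continuous_on \<Omega> (\<lambda>x. b x i)"
    and a_sym: "\<And>x i j. x \<in> \<Omega> \<Longrightarrow> a x i j = a x j i"
    and a_pos: "\<And>x v. x \<in> \<Omega> \<Longrightarrow> \<exists>i. v i \<noteq> 0 \<Longrightarrow> (\<Sum>i\<in>UNIV. \<Sum>j\<in>UNIV. v i * v j * a x i j) > 0"
begin

text \<open>Hopf's barrier is \<open>exp (-\<alpha> |x - q|\<^sup>2) - exp (-\<alpha> R\<^sup>2)\<close> with \<open>\<alpha>\<close> large.\<close>

lemma barrier:
  fixes q y :: "real^'n" and R :: real
  assumes "y \<in> \<Omega>" "y \<noteq> q" "dist y q = R"
  obtains h Dh D2h r where "r > 0" "cball y r \<subseteq> \<Omega>"
    and "\<And>x. (h has_derivative (\<lambda>d. \<Sum>i\<in>UNIV. d $ i * Dh i x)) (at x)"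
    and "\<And>x i. (Dh i has_derivative (\<lambda>d. \<Sum>j\<in>UNIV. d $ j * D2h i j x)) (at x)"
    and "\<And>x. x \<in> cball y r \<Longrightarrow> second_order_op a b Dh D2h x > 0"
    and "h y = 0" "\<And>x. dist x q > R \<Longrightarrow> h x < 0" "\<And>x. h x \<le> 1"
proof -
  \<comment> \<open>Applied to exp (-\<alpha> |x - q|^2) =: E, the operator gives 2 \<alpha> E (2
    \<alpha> A - B). Here A comes from the product of the two outer derivatives and is positive at y
    because y \<noteq> q; B collects the rest.\<close>
  define A where "A x = (\<Sum>i\<in>UNIV. \<Sum>j\<in>UNIV. (x - q) $ i * (x - q) $ j * a x i j)" for x
  define B where "B x = (\<Sum>i\<in>UNIV. a x i i) + (\<Sum>i\<in>UNIV. b x i * (x - q) $ i)" for x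
  have Ay: "A y > 0"
    using a_pos[of y "\<lambda>i. (y - q) $ i"] assms by (auto simp: A_def vec_eq_iff)
  have cont: "continuous_on \<Omega> A" "continuous_on \<Omega> B"
    unfolding A_def B_def by (intro continuous_intros a_cont b_cont)+
  \<comment> \<open>This makes \<alpha> A equal to |B| + 1 at y, so 2 \<alpha> A - B is positive at
    y and, by continuity, nearby; the summand 1 also keeps \<alpha> > 0 when B vanishes.\<close>
  define \<alpha> where "\<alpha> = (\<bar>B y\<bar> + 1) / A y"
  have \<alpha>: "\<alpha> > 0" using Ay by (auto simp: \<alpha>_def intro!: divide_pos_pos)
  have "\<alpha> * A y > B y" using Ay by (simp add: \<alpha>_def)
  then have "2 * (\<alpha> * A y) - B y > 0" using \<alpha> Ay mult_pos_pos[of \<alpha> "A y"] by linarith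
  then have "\<forall>\<^sub>F x in at y within \<Omega>. 2 * (\<alpha> * A x) - B x > 0"
    using cont \<open>y \<in> \<Omega>\<close>
    by (intro order_tendstoD[where y = "2 * (\<alpha> * A y) - B y"] tendsto_intros) (auto simp: continuous_on)
  then obtain d where d: "d > 0" "\<And>x. x \<in> \<Omega> \<Longrightarrow> dist x y < d \<Longrightarrow> 2 * (\<alpha> * A x) - B x > 0"
    using \<open>2 * (\<alpha> * A y) - B y > 0\<close> unfolding eventually_at by (metis dist_self)
  obtain d' where d': "d' > 0" "cball y d' \<subseteq> \<Omega>"
    using open_dom \<open>y \<in> \<Omega>\<close> open_contains_cball by blast
  \<comment> \<open>Halving d keeps the whole closed ball at distance less than d from y.\<close>
  define r where "r = min (d / 2) d'"
  define E where "E x = exp (- \<alpha> * ((x - q) \<bullet> (x - q)))" for x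
  define h where "h x = E x - exp (- \<alpha> * R\<^sup>2)" for x
  define Dh where "Dh i x = - 2 * \<alpha> * (x - q) $ i * E x" for i x
  define D2h where "D2h i j x = (4 * \<alpha>\<^sup>2 * (x - q) $ i * (x - q) $ j - (if i = j then 2 * \<alpha> else 0)) * E x"
    for i j x
  have dE: "(E has_derivative (\<lambda>d. - 2 * \<alpha> * ((x - q) \<bullet> d) * E x)) (at x)" for x
    unfolding E_def by (auto intro!: derivative_eq_intros simp: inner_commute algebra_simps)
  have inner: "(x - q) \<bullet> d = (\<Sum>i\<in>UNIV. d $ i * (x - q) $ i)" for x d
    by (simp add: inner_vec_def mult.commute)
  show ?thesis
  proof (rule that)
    show "r > 0" "cball y r \<subseteq> \<Omega>" using d d' by (auto simp: r_def)
    show "(h has_derivative (\<lambda>d. \<Sum>i\<in>UNIV. d $ i * Dh i x)) (at x)" for x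
    proof -
      have "(h has_derivative (\<lambda>d. - 2 * \<alpha> * ((x - q) \<bullet> d) * E x)) (at x)"
        unfolding h_def by (auto intro!: derivative_eq_intros dE)
      then show ?thesis unfolding inner Dh_def by (simp add: sum_distrib_left sum_distrib_right mult_ac)
    qed
    show "(Dh i has_derivative (\<lambda>d. \<Sum>j\<in>UNIV. d $ j * D2h i j x)) (at x)" for i x
    proof -
      have "((\<lambda>x. - 2 * \<alpha> * (x - q) $ i * E x) has_derivative
          (\<lambda>d. - 2 * \<alpha> * (x - q) $ i * (- 2 * \<alpha> * ((x - q) \<bullet> d) * E x) + (- 2 * \<alpha> * d $ i) * E x)) (at x)"
        by (rule has_derivative_eq_rhs[OF has_derivative_mult[OF _ dE]])
          (auto intro!: derivative_eq_intros bounded_linear_imp_has_derivative bounded_linear_vec_nth)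
      moreover have "(\<Sum>j\<in>UNIV. d $ j * D2h i j x)
          = - 2 * \<alpha> * (x - q) $ i * (- 2 * \<alpha> * ((x - q) \<bullet> d) * E x) + (- 2 * \<alpha> * d $ i) * E x" for d
      proof -
        have "(\<Sum>j\<in>UNIV. d $ j * D2h i j x)
           = (\<Sum>j\<in>UNIV. 4 * \<alpha>\<^sup>2 * (x - q) $ i * E x * (d $ j * (x - q) $ j))
             - (\<Sum>j\<in>UNIV. if i = j then 2 * \<alpha> * d $ j * E x else 0)"
          unfolding sum_subtractf[symmetric] by (intro sum.cong refl) (auto simp: D2h_def algebra_simps)
        then show ?thesis
          unfolding inner sum_distrib_left[symmetric] by (simp add: power2_eq_square algebra_simps)
      qed
      ultimately show ?thesis unfolding Dh_def by simp
    qed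
    show "second_order_op a b Dh D2h x > 0" if "x \<in> cball y r" for x
    proof -
      have "(\<Sum>i\<in>UNIV. \<Sum>j\<in>UNIV. a x i j * D2h i j x)
        = 4 * \<alpha>\<^sup>2 * E x * A x - (\<Sum>i\<in>UNIV. \<Sum>j\<in>UNIV. if i = j then 2 * \<alpha> * E x * a x i j else 0)"
        unfolding A_def sum_distrib_left sum_subtractf[symmetric]
        by (intro sum.cong refl) (auto simp: D2h_def algebra_simps)
      also have "(\<Sum>i\<in>UNIV. \<Sum>j\<in>UNIV. if i = j then 2 * \<alpha> * E x * a x i j else 0)
        = 2 * \<alpha> * E x * (\<Sum>i\<in>UNIV. a x i i)" by (simp add: sum_distrib_left)
      finally have "second_order_op a b Dh D2h x
        = 4 * \<alpha>\<^sup>2 * E x * A x - 2 * \<alpha> * E x * (\<Sum>i\<in>UNIV. a x i i)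
          - 2 * \<alpha> * E x * (\<Sum>i\<in>UNIV. b x i * (x - q) $ i)"
        unfolding second_order_op_def Dh_def by (simp add: sum_distrib_left sum_negf mult_ac)
      also have "\<dots> = 2 * \<alpha> * E x * (2 * (\<alpha> * A x) - B x)"
        by (simp add: B_def algebra_simps power2_eq_square)
      also have "\<dots> > 0"
      proof -
        have "x \<in> \<Omega>" "dist x y < d" using that d(1) d'(2) by (auto simp: r_def dist_commute)
        then show ?thesis using d(2)[of x] \<alpha> by (simp add: E_def)
      qed
      finally show ?thesis .
    qed
    show "h y = 0"
      using assms(3) by (simp add: h_def E_def dist_norm flip: power2_norm_eq_inner)
    show "h x < 0" if "dist x q > R" for x
    proof -
      have "R\<^sup>2 < (norm (x - q))\<^sup>2"
        using that assms(3) by (intro power_strict_mono) (auto simp: dist_norm)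
      then show ?thesis using \<alpha> by (simp add: h_def E_def power2_norm_eq_inner)
    qed
    show "h x \<le> 1" for x
    proof -
      have "E x \<le> 1" using \<alpha> by (simp add: E_def)
      then show ?thesis unfolding h_def using exp_gt_zero[of "- \<alpha> * R\<^sup>2"] by linarith
    qed
  qed
qed

text \<open>A point x near \<open>x1\<close> with u x < m would yield a closed ball on which u < m
  except at one boundary point y. Adding a small multiple of the barrier at y turns u into a strict
  subsolution near y that has an interior maximum on a small ball around y. There the gradient
  vanishes and a positive definite matrix is paired with a nonpositive Hessian, so the operator is
  \<le> 0, against strictness.\<close>

theorem strong_maximum_principle:
  assumes D: "\<And>x. x \<in> \<Omega> \<Longrightarrow> (u has_derivative (\<lambda>d. \<Sum>i\<in>UNIV. d $ i * Du i x)) (at x)"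
    and D2: "\<And>x i. x \<in> \<Omega> \<Longrightarrow> (Du i has_derivative (\<lambda>d. \<Sum>j\<in>UNIV. d $ j * D2u i j x)) (at x)"
    and sub: "\<And>x. x \<in> \<Omega> \<Longrightarrow> second_order_op a b Du D2u x \<ge> 0"
    and le: "\<And>x. x \<in> \<Omega> \<Longrightarrow> u x \<le> m"
  shows "open {x \<in> \<Omega>. u x = m}"
  unfolding open_contains_ball
proof
  fix x1 assume "x1 \<in> {x \<in> \<Omega>. u x = m}"
  then have x1: "x1 \<in> \<Omega>" "u x1 = m" by auto
  have cont: "continuous_on \<Omega> u"
    using D by (intro continuous_at_imp_continuous_on) (auto intro: has_derivative_continuous)
  obtain e where e: "e > 0" "cball x1 e \<subseteq> \<Omega>"
    using open_dom x1 open_contains_cball by blast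
  \<comment> \<open>With half the radius, any point closer to x than \<open>x1\<close> is lies
    within e of \<open>x1\<close>. Cutting the maximum set down to \<open>cball x1 e\<close>
    therefore does not hide any point that could be nearest to x.\<close>
  have "u x = m" if q0: "x \<in> ball x1 (e/2)" for x
  proof (rule ccontr)
    assume ne: "u x \<noteq> m"
    define K where "K = {z \<in> cball x1 e. u z = m}"
    have "closed K"
      unfolding K_def
      using continuous_on_subset[OF cont e(2)] by (intro continuous_closed_preimage_constant) auto
    moreover have "x1 \<in> K" using e x1 by (auto simp: K_def)
    ultimately obtain y where y: "y \<in> K" "\<And>z. z \<in> K \<Longrightarrow> dist x y \<le> dist x z"
      using distance_attains_inf by blast
    \<comment> \<open>Halving the ball around \<open>x\<close> makes it touch the maximum set at \<open>y\<close> only.\<close>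
    define R where "R = dist x y / 2"
    define q where "q = midpoint x y"
    have "dist x y \<le> dist x x1" using y(2)[OF \<open>x1 \<in> K\<close>] .
    have "x \<noteq> y" using y ne by (auto simp: K_def)
    have "y \<in> \<Omega>" "u y = m" using y e by (auto simp: K_def)
    have yq: "dist y q = R" "y \<noteq> q"
      using \<open>x \<noteq> y\<close> midpoint_eq_endpoint(2)[of x y]
      by (auto simp: q_def R_def dist_midpoint dist_commute dest: sym)
    have ball: "u z < m" if z: "z \<in> cball q R" "z \<noteq> y" for z
    proof -
      \<comment> \<open>The parallelogram law at the midpoint q. For z in \<open>cball q R\<close>
        other than y it forces z strictly closer to x than y is, so z cannot belong to K.\<close>
      have "(dist z x)\<^sup>2 + (dist z y)\<^sup>2 = 2 * (dist z q)\<^sup>2 + 2 * R\<^sup>2"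
      proof -
        have "z - x = (z - q) + (y - q)" "z - y = (z - q) - (y - q)"
          by (simp_all add: q_def midpoint_def algebra_simps flip: scaleR_2)
        moreover have "(norm (s + t))\<^sup>2 + (norm (s - t))\<^sup>2 = 2 * (norm s)\<^sup>2 + 2 * (norm t)\<^sup>2"
          for s t :: "real^'n"
          by (simp add: power2_norm_eq_inner inner_simps inner_commute)
        ultimately show ?thesis
          unfolding yq(1)[symmetric] dist_norm by metis
      qed
      moreover have "(dist z q)\<^sup>2 \<le> R\<^sup>2"
        using z by (intro power_mono) (auto simp: dist_commute)
      moreover have "(dist z y)\<^sup>2 > 0" using z by simp
      moreover have "(dist x y)\<^sup>2 = 4 * R\<^sup>2" by (simp add: R_def power_divide)
      ultimately have "(dist z x)\<^sup>2 < (dist x y)\<^sup>2" by linarith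
      then have zx: "dist x z < dist x y"
        using power2_less_imp_less[of "dist z x"] by (simp add: dist_commute)
      then have "z \<notin> K" using y(2)[of z] by fastforce
      have "dist x1 z < e"
        using zx \<open>dist x y \<le> dist x x1\<close> q0 dist_triangle[of x1 z x] by (simp add: dist_commute)
      then show ?thesis
        using \<open>z \<notin> K\<close> le[of z] e(2) by (force simp: K_def)
    qed
    obtain h Dh D2h r where r: "r > 0" "cball y r \<subseteq> \<Omega>"
      and Dh: "\<And>x. (h has_derivative (\<lambda>d. \<Sum>i\<in>UNIV. d $ i * Dh i x)) (at x)"
      and D2h: "\<And>x i. (Dh i has_derivative (\<lambda>d. \<Sum>j\<in>UNIV. d $ j * D2h i j x)) (at x)"
      and Lh: "\<And>x. x \<in> cball y r \<Longrightarrow> second_order_op a b Dh D2h x > 0"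
      and h: "h y = 0" "\<And>x. dist x q > R \<Longrightarrow> h x < 0" "\<And>x. h x \<le> 1"
      by (rule barrier[OF \<open>y \<in> \<Omega>\<close> yq(2,1)]) (rule that)
    \<comment> \<open>The part of the sphere inside \<open>cball q R\<close> is compact and avoids
      y, so u stays below m there by a fixed gap. As h \<le> 1, the perturbation \<epsilon> h cannot
      close it.\<close>
    have "\<exists>\<epsilon>>0. \<forall>x\<in>sphere y r \<inter> cball q R. u x + \<epsilon> < m"
    proof (cases "sphere y r \<inter> cball q R = {}")
      case False
      have "compact (sphere y r \<inter> cball q R)" by (intro compact_Int compact_cball compact_sphere)
      moreover have "continuous_on (sphere y r \<inter> cball q R) u"
        by (rule continuous_on_subset[OF cont]) (use r(2) in auto)
      ultimately obtain w where w: "w \<in> sphere y r \<inter> cball q R"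
          "\<And>x. x \<in> sphere y r \<inter> cball q R \<Longrightarrow> u x \<le> u w"
        using continuous_attains_sup False by metis
      have "u w < m" using w(1) r(1) by (intro ball) auto
      then show ?thesis
        by (intro exI[of _ "(m - u w) / 2"]) (auto simp: field_simps dest!: w(2)[OF IntI])
    qed (auto intro: exI[of _ 1])
    then obtain \<epsilon> where \<epsilon>: "\<epsilon> > 0" "\<And>x. x \<in> sphere y r \<inter> cball q R \<Longrightarrow> u x + \<epsilon> < m"
      by blast
    define v where "v x = u x + \<epsilon> * h x" for x
    define Dv where "Dv i x = Du i x + \<epsilon> * Dh i x" for i x
    define D2v where "D2v i j x = D2u i j x + \<epsilon> * D2h i j x" for i j x
    have dv: "(v has_derivative (\<lambda>d. \<Sum>i\<in>UNIV. d $ i * Dv i x)) (at x)" if "x \<in> \<Omega>" for x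
      unfolding v_def
      by (rule has_derivative_eq_rhs[OF has_derivative_add[OF D[OF that] has_derivative_mult_right[OF Dh]]])
        (simp add: Dv_def fun_eq_iff sum_distrib_left sum.distrib algebra_simps)
    have d2v: "(Dv i has_derivative (\<lambda>d. \<Sum>j\<in>UNIV. d $ j * D2v i j x)) (at x)" if "x \<in> \<Omega>" for x i
      unfolding Dv_def
      by (rule has_derivative_eq_rhs[OF has_derivative_add[OF D2[OF that] has_derivative_mult_right[OF D2h]]])
        (simp add: D2v_def fun_eq_iff sum_distrib_left sum.distrib algebra_simps)
    have "continuous_on (cball y r) v"
      using dv r(2) by (intro continuous_at_imp_continuous_on) (blast intro: has_derivative_continuous)
    then obtain z where z: "z \<in> cball y r" "\<And>x. x \<in> cball y r \<Longrightarrow> v x \<le> v z"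
      using continuous_attains_sup[of "cball y r" v] r(1) by auto
    have "z \<in> \<Omega>" using z(1) r(2) by auto
    have "m \<le> v z" using z(2)[of y] r(1) h(1) \<open>u y = m\<close> by (simp add: v_def)
    \<comment> \<open>At y the barrier vanishes, so the maximum of v is at least m. On the sphere v
      < m: inside \<open>cball q R\<close> by the choice of \<epsilon>, outside it because h < 0 and
      u \<le> m.\<close>
    have "z \<notin> sphere y r"
    proof
      assume s: "z \<in> sphere y r"
      show False
      proof (cases "z \<in> cball q R")
        case True
        then have "u z + \<epsilon> < m" using \<epsilon>(2) s by blast
        moreover have "\<epsilon> * h z \<le> \<epsilon>" using \<epsilon>(1) h(3)[of z] by (simp add: mult_left_le)
        ultimately show False using \<open>m \<le> v z\<close> by (simp add: v_def)
      next
        case False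
        then have "\<epsilon> * h z < 0" using h(2)[of z] \<epsilon>(1) by (auto simp: dist_commute mult_pos_neg)
        then show False using \<open>m \<le> v z\<close> le[OF \<open>z \<in> \<Omega>\<close>] by (simp add: v_def)
      qed
    qed
    then have zb: "z \<in> ball y r" using z(1) by auto
    have in_ball: "x \<in> \<Omega>" "v x \<le> v z" if "x \<in> ball y r" for x
      using that z(2)[of x] r(2) by auto
    have crit: "Dv i z = 0" "(\<Sum>i\<in>UNIV. \<Sum>j\<in>UNIV. e i * e j * D2v i j z) \<le> 0" for i e
      by (rule multivariate_max_conditions[OF open_ball zb];
          fact dv[OF in_ball(1)] d2v[OF \<open>z \<in> \<Omega>\<close>] in_ball(2))+
    have "second_order_op a b Dv D2v z \<le> 0"
    proof -
      have "(\<Sum>i\<in>UNIV. \<Sum>j\<in>UNIV. a z i j * D2v i j z) \<le> 0"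
        by (rule trace_posdef_nonpos[OF finite a_sym a_pos crit(2)]) (use \<open>z \<in> \<Omega>\<close> in auto)
      then show ?thesis unfolding second_order_op_def by (simp add: crit(1))
    qed
    moreover have "second_order_op a b Dv D2v z
        = second_order_op a b Du D2u z + \<epsilon> * second_order_op a b Dh D2h z"
      by (simp add: second_order_op_def Dv_def D2v_def algebra_simps sum.distrib sum_distrib_left)
    moreover have "\<epsilon> * second_order_op a b Dh D2h z > 0"
      using \<epsilon>(1) Lh[OF z(1)] by simp
    ultimately show False using sub[OF \<open>z \<in> \<Omega>\<close>] by linarith
  qed
  moreover have "ball x1 (e/2) \<subseteq> \<Omega>" using e by (auto simp: subset_iff)
  ultimately show "\<exists>d>0. ball x1 d \<subseteq> {x \<in> \<Omega>. u x = m}"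
    using e(1) by (intro exI[of _ "e/2"]) auto
qed

end


section \<open>Partial derivatives and inverse matrices\<close>

lemma has_derivative_partial_deriv:
  fixes F :: "real^'n::finite \<Rightarrow> real"
  assumes "F differentiable (at x)"
  shows "(F has_derivative (\<lambda>d. \<Sum>i\<in>UNIV. d $ i * partial_deriv i F x)) (at x)"
proof -
  have F: "(F has_derivative frechet_derivative F (at x)) (at x)"
    using assms frechet_derivative_works by blast
  then have lin: "linear (frechet_derivative F (at x))"
    by (rule has_derivative_linear)
  have *: "frechet_derivative F (at x) = (\<lambda>d. \<Sum>i\<in>UNIV. d $ i * partial_deriv i F x)"
  proof
    fix d :: "real^'n"
    have "frechet_derivative F (at x) d = frechet_derivative F (at x) (\<Sum>i\<in>UNIV. d $ i *\<^sub>R axis i 1)"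
      using basis_expansion[of d] by (simp add: scalar_mult_eq_scaleR)
    then show "frechet_derivative F (at x) d = (\<Sum>i\<in>UNIV. d $ i * partial_deriv i F x)"
      by (simp add: linear_sum[OF lin] linear_cmul[OF lin] partial_deriv_def)
  qed
  show ?thesis using F by (simp only: *)
qed

lemma partial_deriv_eqI: "(F has_derivative D) (at x) \<Longrightarrow> partial_deriv i F x = D (axis i 1)"
  unfolding partial_deriv_def using frechet_derivative_at by metis

lemma smooth_on_partial_derivs:
  fixes F :: "real^'n::finite \<Rightarrow> real"
  assumes "open S" "smooth_on S F"
  shows "F differentiable_on S" "partial_deriv i F differentiable_on S"
    and "\<And>x. x \<in> S \<Longrightarrow> F differentiable (at x)" "\<And>x. x \<in> S \<Longrightarrow> partial_deriv i F differentiable (at x)"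
    and "continuous_on S F" "continuous_on S (partial_deriv i F)"
proof -
  note smooth = assms(2)[unfolded smooth_on_def, rule_format]
  show 1: "F differentiable_on S" "partial_deriv i F differentiable_on S"
    using smooth[of "[]"] smooth[of "[i]"] by simp_all
  then show "\<And>x. x \<in> S \<Longrightarrow> F differentiable (at x)" "\<And>x. x \<in> S \<Longrightarrow> partial_deriv i F differentiable (at x)"
    unfolding differentiable_on_eq_differentiable_at[OF assms(1)] by blast+
  show "continuous_on S F" "continuous_on S (partial_deriv i F)"
    by (rule differentiable_imp_continuous_on; fact 1)+
qed

section \<open>Continuity and positivity of the inverse matrix\<close>

lemma continuous_on_det:
  fixes A :: "'b::topological_space \<Rightarrow> real^'n::finite^'n"
  assumes "\<And>i j. continuous_on S (\<lambda>x. A x $ i $ j)"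
  shows "continuous_on S (\<lambda>x. det (A x))"
  unfolding det_def by (intro continuous_intros assms)

lemma matrix_inv_inverse:
  fixes A :: "'b::semiring_1^'n^'m"
  assumes "invertible A"
  shows "A ** matrix_inv A = mat 1" "matrix_inv A ** A = mat 1"
  using someI_ex[OF assms[unfolded invertible_def]] unfolding matrix_inv_def by blast+

text \<open>Column j of the inverse solves \<open>A *v x = axis j 1\<close>, so Cramer's rule
  applies. Entries of the inverse become quotients of determinants, through which continuity passes
  from A to its inverse.\<close>

lemma matrix_inv_component:
  fixes A :: "real^'n::finite^'n"
  assumes "det A \<noteq> 0"
  shows "matrix_inv A $ i $ j = det (\<chi> r s. if s = i then axis j 1 $ r else A $ r $ s) / det A"
proof -
  have "A ** matrix_inv A = mat 1"
    using assms by (simp add: matrix_inv_inverse invertible_det_nz)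
  then have "A *v (matrix_inv A *v axis j 1) = axis j 1"
    by (simp add: matrix_vector_mul_assoc)
  then have "matrix_inv A *v axis j 1
      = (\<chi> i. det (\<chi> r s. if s = i then axis j 1 $ r else A $ r $ s) / det A)"
    using cramer[OF assms] by blast
  then show ?thesis
    by (simp add: vec_eq_iff matrix_vector_mult_basis column_def)
qed

lemma continuous_on_matrix_inv:
  fixes A :: "'b::topological_space \<Rightarrow> real^'n::finite^'n"
  assumes "\<And>i j. continuous_on S (\<lambda>x. A x $ i $ j)"
    and "\<And>x. x \<in> S \<Longrightarrow> invertible (A x)"
  shows "continuous_on S (\<lambda>x. matrix_inv (A x) $ i $ j)"
proof -
  have det: "det (A x) \<noteq> 0" if "x \<in> S" for x using assms(2)[OF that] by (simp add: invertible_det_nz)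
  have "continuous_on S (\<lambda>x. (if s = i then axis j 1 $ r else A x $ r $ s) :: real)" for r s
    using assms(1) by (cases "s = i") auto
  then have "continuous_on S (\<lambda>x. det (\<chi> r s. if s = i then axis j 1 $ r else A x $ r $ s) / det (A x))"
    using det by (intro continuous_intros continuous_on_det assms(1)) auto
  then show ?thesis
    by (rule continuous_on_eq) (simp add: matrix_inv_component det)
qed

text \<open>Substituting v = A w turns the form of the inverse at v into the form of A at w. For the
  metric this gives the ellipticity of the Laplacian, whose leading coefficients are the inverse
  metric.\<close>

lemma posdef_matrix_inv:
  fixes A :: "real^'n::finite^'n"
  assumes "transpose A = A" and pos: "\<And>v. v \<noteq> 0 \<Longrightarrow> v \<bullet> (A *v v) > 0"
  shows "invertible A" "transpose (matrix_inv A) = matrix_inv A"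
    and "v \<noteq> 0 \<Longrightarrow> v \<bullet> (matrix_inv A *v v) > 0"
proof -
  have "v = 0" if "A *v v = 0" for v
    using pos[of v] that by auto
  then show inv: "invertible A"
    unfolding invertible_left_inverse matrix_left_invertible_ker by blast
  then have r: "A ** matrix_inv A = mat 1"
    by (simp add: matrix_inv_inverse)
  have "transpose (matrix_inv A) ** A = mat 1"
    by (metis assms(1) matrix_transpose_mul r transpose_mat)
  then show "transpose (matrix_inv A) = matrix_inv A"
    by (metis r matrix_mul_assoc matrix_mul_lid matrix_mul_rid)
  define w where "w = matrix_inv A *v v"
  have Aw: "A *v w = v" by (simp add: w_def matrix_vector_mul_assoc r)
  assume "v \<noteq> 0"
  then have "w \<noteq> 0" using Aw by auto
  then have "w \<bullet> (A *v w) > 0" by (rule pos)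
  then show "v \<bullet> (matrix_inv A *v v) > 0"
    unfolding Aw by (simp add: w_def inner_commute)
qed

section \<open>Harmonic functions in charts\<close>

lemma chart_inv_simps:
  assumes "is_chart M c"
  shows "x \<in> snd c ` fst c \<Longrightarrow> chart_inv c x \<in> fst c"
    and "x \<in> snd c ` fst c \<Longrightarrow> snd c (chart_inv c x) = x"
    and "p \<in> fst c \<Longrightarrow> chart_inv c (snd c p) = p"
proof -
  have sub: "fst c \<subseteq> topspace M" using assms openin_subset by (auto simp: is_chart_def)
  then have "inj_on (snd c) (fst c)"
    using assms homeomorphic_imp_injective_map[of "subtopology M (fst c)"]
    by (fastforce simp: is_chart_def inf.absorb2)
  then show "p \<in> fst c \<Longrightarrow> chart_inv c (snd c p) = p" by (simp add: chart_inv_def)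
  show "x \<in> snd c ` fst c \<Longrightarrow> chart_inv c x \<in> fst c" by (simp add: chart_inv_def inv_into_into)
  show "x \<in> snd c ` fst c \<Longrightarrow> snd c (chart_inv c x) = x" by (simp add: chart_inv_def f_inv_into_f)
qed

lemma openin_chart_preimage:
  assumes "is_chart M c" "open T"
  shows "openin M {p \<in> fst c. snd c p \<in> T}"
proof -
  have "continuous_map (subtopology M (fst c)) euclidean (snd c)"
    using assms by (auto simp: is_chart_def dest!: homeomorphic_imp_continuous_map continuous_map_into_fulltopology)
  then have "openin (subtopology M (fst c)) {p \<in> topspace (subtopology M (fst c)). snd c p \<in> T}"
    using assms(2) by (intro openin_continuous_map_preimage) auto
  moreover have "topspace (subtopology M (fst c)) = fst c"
    using assms openin_subset by (fastforce simp: is_chart_def)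
  ultimately show ?thesis
    using assms by (simp add: is_chart_def openin_open_subtopology del: topspace_subtopology)
qed

text \<open>With u = f - \<xi> in coordinates, W is the gradient of u, hence Du = g W.
  Differentiating and contracting with the inverse metric gives a first-order expression in W, in
  which div W = 0 removes the derivatives of W. Replacing W by the gradient again leaves an elliptic
  equation for u.\<close>

lemma chart_harmonic_max_open:
  fixes A :: "('a, 'n::finite) chart set"
  assumes c: "is_chart M c" "c \<in> A" and g: "riemannian_metric A g"
    and f: "smooth_function A f" and \<xi>: "smooth_function A \<xi>" and W: "smooth_vector_field A W"
    and div0: "\<And>p. p \<in> fst c \<Longrightarrow> divergence g W c p = 0"
    and grad: "\<And>p. p \<in> fst c \<Longrightarrow> gradient g f c p = W c p + gradient g \<xi> c p"
    and le: "\<And>p. p \<in> fst c \<Longrightarrow> f p - \<xi> p \<le> m"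
  shows "open {x \<in> snd c ` fst c. f (chart_inv c x) - \<xi> (chart_inv c x) = m}"
proof -
  define V where "V = snd c ` fst c"
  have V: "open V" using c by (simp add: is_chart_def V_def)
  define p where "p = chart_inv c"
  have p: "p x \<in> fst c" "snd c (p x) = x" if "x \<in> V" for x
    using chart_inv_simps[OF c(1)] that by (auto simp: p_def V_def)
  have cd: "chart_deriv c i u (p x) = partial_deriv i (\<lambda>x. u (p x)) x" if "x \<in> V" for i u x
    using p[OF that] by (simp add: chart_deriv_def comp_def p_def)
  have sm: "smooth_on V (\<lambda>x. f (p x))" "smooth_on V (\<lambda>x. \<xi> (p x))"
    "smooth_on V (\<lambda>x. W c (p x) $ k)" "smooth_on V (\<lambda>x. g c (p x) $ k $ l)" for k l
    using f \<xi> W g c(2)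
    by (auto simp: smooth_function_def smooth_in_chart_def smooth_vector_field_def riemannian_metric_def
        V_def p_def comp_def)
  note sm_f = smooth_on_partial_derivs[OF V sm(1)] and sm_\<xi> = smooth_on_partial_derivs[OF V sm(2)]
    and sm_W = smooth_on_partial_derivs[OF V sm(3)] and sm_g = smooth_on_partial_derivs[OF V sm(4)]
  define a where "a x = matrix_inv (g c (p x))" for x
  have gpos: "transpose (g c (p x)) = g c (p x)" "v \<noteq> 0 \<Longrightarrow> v \<bullet> (g c (p x) *v v) > 0"
    if "x \<in> V" for x v
    using g c(2) p[OF that] unfolding riemannian_metric_def by blast+
  have ginv: "invertible (g c (p x))" "transpose (a x) = a x" "v \<noteq> 0 \<Longrightarrow> v \<bullet> (a x *v v) > 0"
    if "x \<in> V" for x v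
    using posdef_matrix_inv[OF gpos[OF that]] by (auto simp: a_def)
  have a_cont: "continuous_on V (\<lambda>x. a x $ i $ j)" for i j
    unfolding a_def by (intro continuous_on_matrix_inv sm_g ginv)
  have a_sym: "a x $ i $ j = a x $ j $ i" if "x \<in> V" for x i j
    using ginv(2)[OF that] by (metis transpose_def vec_lambda_beta)
  have a_pos: "(\<Sum>i\<in>UNIV. \<Sum>j\<in>UNIV. v i * v j * a x $ i $ j) > 0" if "x \<in> V" "\<exists>i. v i \<noteq> 0" for x v
    using ginv(3)[OF that(1), of "\<chi> i. v i"] that(2)
    by (simp add: vec_eq_iff inner_vec_def matrix_vector_mult_def sum_distrib_left mult_ac)
  \<comment> \<open>P arises when the derivative in D(g W) hits g, and Q is the Christoffel trace in
    div W. The leading part of the operator will equal the sum of (P k - Q k) times the components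
    of W; b is minus this covector with its index raised, so that the two parts cancel.\<close>
  define P where "P k x = (\<Sum>i\<in>UNIV. \<Sum>j\<in>UNIV. a x $ i $ j * partial_deriv j (\<lambda>x. g c (p x) $ i $ k) x)"
    for k x
  define Q where "Q k x = (\<Sum>i\<in>UNIV. christoffel g c i i k (p x))" for k x
  define b where "b x l = - (\<Sum>k\<in>UNIV. (P k x - Q k x) * a x $ k $ l)" for x l
  have P_cont: "continuous_on V (P k)" for k
    unfolding P_def by (intro continuous_intros a_cont sm_g)
  have Q_cont: "continuous_on V (Q k)" for k
  proof -
    have "continuous_on V (\<lambda>x. \<Sum>i\<in>UNIV. 1/2 * (\<Sum>l\<in>UNIV. a x $ i $ l *
       (partial_deriv i (\<lambda>x. g c (p x) $ k $ l) x + partial_deriv k (\<lambda>x. g c (p x) $ i $ l) x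
         - partial_deriv l (\<lambda>x. g c (p x) $ i $ k) x)))"
      by (intro continuous_intros a_cont sm_g)
    then show ?thesis
      by (rule continuous_on_eq) (simp add: Q_def christoffel_def cd a_def)
  qed
  have b_cont: "continuous_on V (\<lambda>x. b x l)" for l
    unfolding b_def by (intro continuous_intros a_cont P_cont Q_cont)
  interpret elliptic_operator V "\<lambda>x i j. a x $ i $ j" b
    by (rule elliptic_operator.intro; fact V a_cont b_cont a_sym a_pos)
  define u where "u x = f (p x) - \<xi> (p x)" for x
  define Du where "Du i x = partial_deriv i (\<lambda>x. f (p x)) x - partial_deriv i (\<lambda>x. \<xi> (p x)) x" for i x
  define D2u where "D2u i j x = partial_deriv j (Du i) x" for i j x
  have du: "(u has_derivative (\<lambda>d. \<Sum>i\<in>UNIV. d $ i * Du i x)) (at x)" if "x \<in> V" for x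
    unfolding u_def
    by (rule has_derivative_eq_rhs[OF has_derivative_diff[OF
          has_derivative_partial_deriv[OF sm_f(3)[OF that]] has_derivative_partial_deriv[OF sm_\<xi>(3)[OF that]]]])
      (simp add: Du_def fun_eq_iff right_diff_distrib sum_subtractf)
  have d2u: "(Du i has_derivative (\<lambda>d. \<Sum>j\<in>UNIV. d $ j * D2u i j x)) (at x)" if "x \<in> V" for x i
    unfolding D2u_def
    by (rule has_derivative_partial_deriv)
      (unfold Du_def, intro differentiable_diff sm_f sm_\<xi> that)
  have aDu: "W c (p x) $ k = (\<Sum>l\<in>UNIV. a x $ k $ l * Du l x)" if "x \<in> V" for x k
  proof -
    have "W c (p x) = gradient g f c (p x) - gradient g \<xi> c (p x)"
      using grad[OF p(1)[OF that]] by simp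
    also have "\<dots> = a x *v (\<chi> l. Du l x)"
      unfolding gradient_def a_def[symmetric] matrix_vector_mult_diff_distrib[symmetric]
      by (rule arg_cong[where f = "(*v) (a x)"]) (simp add: vec_eq_iff cd that Du_def)
    finally show ?thesis by (simp add: matrix_vector_mult_def)
  qed
  have Du_W: "Du i x = (\<Sum>k\<in>UNIV. g c (p x) $ i $ k * W c (p x) $ k)" if "x \<in> V" for x i
  proof -
    have "W c (p x) = a x *v (\<chi> l. Du l x)"
      by (simp add: vec_eq_iff matrix_vector_mult_def aDu that)
    then have "g c (p x) *v W c (p x) = (\<chi> l. Du l x)"
      using ginv(1)[OF that] by (simp add: matrix_vector_mul_assoc matrix_inv_inverse a_def)
    then show ?thesis by (simp add: vec_eq_iff matrix_vector_mult_def)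
  qed
  have D2u: "D2u i j x = (\<Sum>k\<in>UNIV. partial_deriv j (\<lambda>x. g c (p x) $ i $ k) x * W c (p x) $ k
      + g c (p x) $ i $ k * partial_deriv j (\<lambda>x. W c (p x) $ k) x)" if x: "x \<in> V" for i j x
  proof -
    have *: "(Du i has_derivative (\<lambda>d. \<Sum>k\<in>UNIV.
        g c (p x) $ i $ k * (\<Sum>j\<in>UNIV. d $ j * partial_deriv j (\<lambda>x. W c (p x) $ k) x)
        + (\<Sum>j\<in>UNIV. d $ j * partial_deriv j (\<lambda>x. g c (p x) $ i $ k) x) * W c (p x) $ k)) (at x)"
      by (rule has_derivative_transform_within_open[OF _ V x Du_W[symmetric]])
        (intro has_derivative_sum has_derivative_mult has_derivative_partial_deriv sm_g sm_W x)
    show ?thesis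
      unfolding D2u_def partial_deriv_eqI[OF *]
      by (simp add: axis_def add.commute if_distrib[of "\<lambda>t. t * _"] cong: if_cong)
  qed
  have "second_order_op (\<lambda>x i j. a x $ i $ j) b Du D2u x = 0" if x: "x \<in> V" for x
  proof -
    let ?w = "\<lambda>k. W c (p x) $ k" and ?dw = "\<lambda>j k. partial_deriv j (\<lambda>x. W c (p x) $ k) x"
    have "a x ** g c (p x) = mat 1"
      using ginv(1)[OF x] by (simp add: a_def matrix_inv_inverse)
    then have \<delta>: "(\<Sum>i\<in>UNIV. a x $ j $ i * g c (p x) $ i $ k) = (if j = k then 1 else 0)" for j k
      by (simp add: vec_eq_iff matrix_matrix_mult_def mat_def)
    \<comment> \<open>Symmetry of \<open>a\<close> lets the terms with derivatives of W be written
      so that the sum over i is a Kronecker delta, leaving the plain trace of these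
      derivatives.\<close>
    have "(\<Sum>i\<in>UNIV. \<Sum>j\<in>UNIV. a x $ i $ j * D2u i j x)
      = (\<Sum>i\<in>UNIV. \<Sum>j\<in>UNIV. \<Sum>k\<in>UNIV. a x $ i $ j * partial_deriv j (\<lambda>x. g c (p x) $ i $ k) x * ?w k)
        + (\<Sum>i\<in>UNIV. \<Sum>j\<in>UNIV. \<Sum>k\<in>UNIV. a x $ j $ i * g c (p x) $ i $ k * ?dw j k)"
      unfolding D2u[OF x] sum_distrib_left sum.distrib[symmetric]
      by (intro sum.cong refl) (simp add: a_sym[OF x] algebra_simps)
    also have "(\<Sum>i\<in>UNIV. \<Sum>j\<in>UNIV. \<Sum>k\<in>UNIV. a x $ i $ j * partial_deriv j (\<lambda>x. g c (p x) $ i $ k) x * ?w k)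
       = (\<Sum>i\<in>UNIV. \<Sum>k\<in>UNIV. \<Sum>j\<in>UNIV. a x $ i $ j * partial_deriv j (\<lambda>x. g c (p x) $ i $ k) x * ?w k)"
      by (rule sum.cong[OF refl]) (rule sum.swap)
    also have "\<dots> = (\<Sum>k\<in>UNIV. P k x * ?w k)"
      by (subst sum.swap) (simp add: P_def sum_distrib_right)
    also have "(\<Sum>i\<in>UNIV. \<Sum>j\<in>UNIV. \<Sum>k\<in>UNIV. a x $ j $ i * g c (p x) $ i $ k * ?dw j k)
       = (\<Sum>j\<in>UNIV. \<Sum>i\<in>UNIV. \<Sum>k\<in>UNIV. a x $ j $ i * g c (p x) $ i $ k * ?dw j k)"
      by (rule sum.swap)
    also have "\<dots> = (\<Sum>j\<in>UNIV. \<Sum>k\<in>UNIV. \<Sum>i\<in>UNIV. a x $ j $ i * g c (p x) $ i $ k * ?dw j k)"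
      by (rule sum.cong[OF refl]) (rule sum.swap)
    also have "\<dots> = (\<Sum>j\<in>UNIV. ?dw j j)"
      unfolding sum_distrib_right[symmetric] \<delta>
      by (simp add: if_distrib[of "\<lambda>t. t * _"] cong: if_cong)
    \<comment> \<open>Here div W = 0 trades the trace of the derivatives of W for a term linear in W
      itself.\<close>
    also have "(\<Sum>j\<in>UNIV. ?dw j j) = - (\<Sum>k\<in>UNIV. Q k x * ?w k)"
    proof -
      have "(\<Sum>i\<in>UNIV. ?dw i i) + (\<Sum>i\<in>UNIV. \<Sum>k\<in>UNIV. christoffel g c i i k (p x) * ?w k) = 0"
        using div0[OF p(1)[OF x]]
        by (simp add: divergence_def covariant_deriv_def sum.distrib cd x)
      moreover have "(\<Sum>i\<in>UNIV. \<Sum>k\<in>UNIV. christoffel g c i i k (p x) * ?w k) = (\<Sum>k\<in>UNIV. Q k x * ?w k)"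
        by (subst sum.swap) (simp add: Q_def sum_distrib_right)
      ultimately show ?thesis by simp
    qed
    also have "(\<Sum>k\<in>UNIV. P k x * ?w k) + - (\<Sum>k\<in>UNIV. Q k x * ?w k)
       = (\<Sum>k\<in>UNIV. \<Sum>l\<in>UNIV. (P k x - Q k x) * a x $ k $ l * Du l x)"
      by (simp add: aDu[OF x] sum_subtractf left_diff_distrib sum_distrib_left mult.assoc)
    also have "\<dots> = - (\<Sum>l\<in>UNIV. b x l * Du l x)"
      by (subst sum.swap) (simp add: b_def sum_distrib_right sum_negf)
    finally show ?thesis by (simp add: second_order_op_def)
  qed
  then have "open {x \<in> V. u x = m}"
    using le p by (intro strong_maximum_principle[OF du d2u]) (auto simp: u_def)
  then show ?thesis by (simp add: u_def V_def p_def)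
qed

section \<open>From charts to the manifold\<close>

text \<open>Continuity is local, so a chart around each point suffices. It provides both the
  attained maximum of \<open>f - \<xi>\<close> on the compact manifold and the closedness of the set
  where it is attained.\<close>

lemma smooth_function_continuous_map:
  assumes "smooth_atlas M A" "smooth_function A u"
  shows "continuous_map M euclideanreal u"
  unfolding continuous_map
proof (intro conjI allI impI)
  fix T :: "real set"
  assume "openin euclidean T"
  show "openin M {p \<in> topspace M. u p \<in> T}"
  proof (subst openin_subopen, clarify)
    fix q assume q: "q \<in> topspace M" "u q \<in> T"
    then obtain c where c: "c \<in> A" "q \<in> fst c" using assms(1) by (metis UN_iff smooth_atlas_def)
    then have ch: "is_chart M c" using assms(1) by (auto simp: smooth_atlas_def)
    let ?V = "snd c ` fst c" and ?u = "u \<circ> chart_inv c"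
    have V: "open ?V" using ch by (simp add: is_chart_def)
    have "continuous_on ?V ?u"
      using assms(2) c smooth_on_partial_derivs(5)[OF V]
      unfolding smooth_function_def smooth_in_chart_def by blast
    then have "open (?u -` T \<inter> ?V)"
      using continuous_on_open_vimage[OF V, of ?u] \<open>openin euclidean T\<close> by simp
    from openin_chart_preimage[OF ch this]
    have "openin M {p \<in> fst c. u p \<in> T}"
      using chart_inv_simps(3)[OF ch] by (simp add: imageI cong: conj_cong)
    then show "\<exists>N. openin M N \<and> q \<in> N \<and> N \<subseteq> {p \<in> topspace M. u p \<in> T}"
      using c q ch openin_subset
      by (intro exI[of _ "{p \<in> fst c. u p \<in> T}"]) (fastforce simp: is_chart_def)
  qed
qed auto

theorem theorem1p2:
  fixes M :: "'a topology" and A :: "('a, 'n::finite) chart set" and g :: "('a, 'n) metric"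
    and X :: "('a, 'n) vector_field" and f \<xi> :: "'a \<Rightarrow> real" and m :: ereal and lam :: real
  assumes "oriented_smooth_manifold M A"
    and "connected_space M"
    and "compact_space M"
    and "CARD('n) > 2"
    and "riemannian_metric A g"
    and "0 < m"
    and "smooth_function A f"
    and "smooth_vector_field A X"
    and "\<forall>c\<in>A. \<forall>p\<in>fst c. X c p = gradient g f c p"
    and "quasi_einstein A g X m lam"
    and "hodge_de_rham_potential A g X \<xi>"
  shows "\<exists>C1::real. \<forall>p\<in>topspace M. f p = \<xi> p + C1"
proof (cases "topspace M = {}")
  \<comment> \<open>The empty space is split off because a maximum needs a point; there any constant
    serves.\<close>
  case False
  have atlas: "smooth_atlas M A"
    using assms(1) by (simp add: oriented_smooth_manifold_def smooth_manifold_def)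
  obtain W where W: "smooth_vector_field A W"
      "\<And>c p. c \<in> A \<Longrightarrow> p \<in> fst c \<Longrightarrow> divergence g W c p = 0"
      "\<And>c p. c \<in> A \<Longrightarrow> p \<in> fst c \<Longrightarrow> gradient g f c p = W c p + gradient g \<xi> c p"
    and \<xi>: "smooth_function A \<xi>"
    using assms(9,11) by (auto simp: hodge_de_rham_potential_def)
  have cont: "continuous_map M euclideanreal (\<lambda>p. f p - \<xi> p)"
    using smooth_function_continuous_map[OF atlas] assms(7) \<xi> by (intro continuous_map_diff)
  have "compact ((\<lambda>p. f p - \<xi> p) ` topspace M)"
    using image_compactin[OF _ cont] assms(3) by (simp add: compact_space_def)
  \<comment> \<open>The maximum of \<open>f - \<xi>\<close> is the constant that the theorem asks
    for.\<close>
  then obtain C where C: "C \<in> (\<lambda>p. f p - \<xi> p) ` topspace M"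
      "\<And>p. p \<in> topspace M \<Longrightarrow> f p - \<xi> p \<le> C"
    using compact_attains_sup[of "(\<lambda>p. f p - \<xi> p) ` topspace M"] False by blast
  define Z where "Z = {p \<in> topspace M. f p - \<xi> p = C}"
  have "closedin M Z"
    using closedin_continuous_map_preimage[OF cont, of "{C}"] by (simp add: Z_def)
  moreover have "openin M Z"
  proof (subst openin_subopen, clarify)
    fix q assume q: "q \<in> Z"
    then obtain c where c: "c \<in> A" "q \<in> fst c"
      using atlas unfolding smooth_atlas_def Z_def by blast
    then have ch: "is_chart M c" using atlas by (auto simp: smooth_atlas_def)
    have sub: "fst c \<subseteq> topspace M" using ch openin_subset by (auto simp: is_chart_def)
    have "open {x \<in> snd c ` fst c. f (chart_inv c x) - \<xi> (chart_inv c x) = C}"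
      using sub by (intro chart_harmonic_max_open[OF ch c(1) assms(5,7) \<xi> W(1)] W(2,3) C(2) c(1)) auto
    from openin_chart_preimage[OF ch this]
    have "openin M {p \<in> fst c. f p - \<xi> p = C}"
      using chart_inv_simps(3)[OF ch] by (simp add: imageI cong: conj_cong)
    then show "\<exists>N. openin M N \<and> q \<in> N \<and> N \<subseteq> Z"
      using c q sub by (intro exI[of _ "{p \<in> fst c. f p - \<xi> p = C}"]) (auto simp: Z_def)
  qed
  moreover have "Z \<noteq> {}" using C(1) by (auto simp: Z_def)
  ultimately have "Z = topspace M"
    using assms(2) by (auto simp: connected_space_clopen_in)
  then have "f p - \<xi> p = C" if "p \<in> topspace M" for p
    using that unfolding Z_def by blast
  then show ?thesis by (intro exI[of _ C]) (simp add: algebra_simps)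
qed auto

end
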